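(* Let $u = (u_0,\dots,u_{T-1}) \in \mathbb{R}^{q\times T}$ be a control, let $h = h(u) = (h_0,\dots,h_T)$ be the solution in $\mathcal{H}$ of the control system $h_{t+1} - h_t = A[u_t]h_t$ ($t=0,\dots,T-1$), $h_0=\phi_0$, and let $h^*=(h^*_0,\dots,h^*_T)$ be the adjoint response along $h$, i.e. the solution in $\mathcal{H}$ of the linear terminal value problem $$h^*_{t+1} - h^*_t = -A^*[u_t]h^*_{t+1} - D_1L_t(h_t,u_t)\quad (t=0,\dots,T-1),\qquad h^*_T = DF(h_T).$$ Then the gradient $D\mathcal{E}(u)\in\mathbb{R}^{q\times T}$ of the cost function $$\mathcal{E}(u) = F(h_T(u)) + \sum_{t=0}^{T-1} L_t(h_t(u),u_t)$$ with respect to the controls is given, for every $u \in \mathbb{R}^{q\times T}$, every $i=1,\dots,q$ and every $t=0,\dots,T-1$, by $$D\mathcal{E}(u)_{i,t} = \langle h^*_{t+1}, A_i h_t\rangle_{\mathcal{H}} + D_{2,i}L_t(h_t,u_t).$$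
   Context: $\mathcal{H}$ is a (real) reproducing kernel Hilbert space of functions on a state space $\mathcal{X}$ with kernel $k$; $T,q\in\mathbb{N}$ are positive; $\phi_0\in\mathcal{H}$ is fixed; $A_1,\dots,A_q$ are bounded linear operators on $\mathcal{H}$. For $v=(v_1,\dots,v_q)\in\mathbb{R}^q$ write $A[v] = v_1A_1+\dots+v_qA_q$ and $A^*[v] = v_1A_1^*+\dots+v_qA_q^*$, where $A_i^*$ is the Hilbert-space adjoint of $A_i$. A control is $u=(u_0,\dots,u_{T-1})\in\mathbb{R}^{q\times T}$ with $u_t = (u_{1,t},\dots,u_{q,t})\in\mathbb{R}^q$. $F:\mathcal{H}\to\mathbb{R}$ (terminal cost) and $L_t:\mathcal{H}\times\mathbb{R}^q\to\mathbb{R}$, $t=0,\dots,T-1$ (time-dependent costs), are differentiable. $DF(h)\in\mathcal{H}$ is the gradient of $F$ at $h$ (derivative identified with an element of $\mathcal{H}$ by the Riesz theorem); $D_1L_t(h,v)\in\mathcal{H}$ is the gradient of $L_t$ in its first argument, identified in the same way; $D_{2,i}L_t(h,v)\in\mathbb{R}$ is the partial derivative of $L_t$ with respect to the $i$-th coordinate $v_i$ of its second argument. $D\mathcal{E}(u)_{i,t}$ is the partial derivative of $\mathcal{E}$ with respect to $u_{i,t}$. *)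

theory Defs
  imports "HOL-Analysis.Analysis"
begin

text \<open>
  A reproducing kernel Hilbert space is given by a Hilbert space type \<open>'h\<close> together with a
  map \<open>ev\<close> that identifies each \<open>h\<close> with a real function \<open>ev h\<close> on the state space \<open>'x\<close>;
  injectivity says that the elements of \<open>'h\<close> are these functions. The \<open>K\<close> below is the
  element \<open>k(x, \<cdot>)\<close> of the space.
\<close>

definition rkhs ::
  "('x \<Rightarrow> 'x \<Rightarrow> real) \<Rightarrow> ('h::{real_inner,complete_space} \<Rightarrow> 'x \<Rightarrow> real) \<Rightarrow> bool" where
  "rkhs k ev \<longleftrightarrow>
     inj ev \<and> (\<forall>x. linear (\<lambda>h. ev h x)) \<and>
     (\<forall>x. \<exists>K. ev K = k x \<and> (\<forall>h. ev h x = h \<bullet> K))"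

definition gradient :: "('h::{real_inner,complete_space} \<Rightarrow> real) \<Rightarrow> 'h \<Rightarrow> 'h" where
  "gradient f x = (THE D. GDERIV f x :> D)"

definition coord_upd :: "real ^ 'q \<Rightarrow> 'q \<Rightarrow> real \<Rightarrow> real ^ 'q" where
  "coord_upd v i s = (\<chi> j. if j = i then s else v $ j)"

definition partial_deriv :: "(real ^ 'q \<Rightarrow> real) \<Rightarrow> real ^ 'q \<Rightarrow> 'q \<Rightarrow> real" where
  "partial_deriv f v i = deriv (\<lambda>s. f (coord_upd v i s)) (v $ i)"

definition lin_comb :: "('q::finite \<Rightarrow> 'h \<Rightarrow> 'h::real_vector) \<Rightarrow> real ^ 'q \<Rightarrow> 'h \<Rightarrow> 'h" where
  "lin_comb A v h = (\<Sum>i\<in>UNIV. v $ i *\<^sub>R A i h)"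

text \<open>
  A control is a sequence \<open>u :: nat \<Rightarrow> real ^ 'q\<close> of which only \<open>u 0, \<dots>, u (T - 1)\<close> matter;
  likewise only the entries \<open>0, \<dots>, T\<close> of a response or an adjoint response matter.
\<close>

definition is_response ::
  "nat \<Rightarrow> 'h \<Rightarrow> ('q::finite \<Rightarrow> 'h \<Rightarrow> 'h::real_inner) \<Rightarrow> (nat \<Rightarrow> real ^ 'q) \<Rightarrow> (nat \<Rightarrow> 'h) \<Rightarrow> bool"
where
  "is_response T \<phi>0 A u h \<longleftrightarrow>
     h 0 = \<phi>0 \<and> (\<forall>t<T. h (Suc t) - h t = lin_comb A (u t) (h t))"

definition is_adjoint_response ::
  "nat \<Rightarrow> ('q::finite \<Rightarrow> 'h \<Rightarrow> 'h) \<Rightarrow> ('h \<Rightarrow> real) \<Rightarrow> (nat \<Rightarrow> 'h \<times> (real ^ 'q) \<Rightarrow> real) \<Rightarrow>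
   (nat \<Rightarrow> real ^ 'q) \<Rightarrow> (nat \<Rightarrow> 'h) \<Rightarrow> (nat \<Rightarrow> 'h::{real_inner,complete_space}) \<Rightarrow> bool"
where
  "is_adjoint_response T A F L u h hs \<longleftrightarrow>
     hs T = gradient F (h T) \<and>
     (\<forall>t<T. hs (Suc t) - hs t =
        - lin_comb (\<lambda>i. adjoint (A i)) (u t) (hs (Suc t)) - gradient (\<lambda>g. L t (g, u t)) (h t))"

definition cost ::
  "nat \<Rightarrow> ('h \<Rightarrow> real) \<Rightarrow> (nat \<Rightarrow> 'h \<times> (real ^ 'q) \<Rightarrow> real) \<Rightarrow>
   ((nat \<Rightarrow> real ^ 'q) \<Rightarrow> nat \<Rightarrow> 'h) \<Rightarrow> (nat \<Rightarrow> real ^ 'q) \<Rightarrow> real"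
where
  "cost T F L h u = F (h u T) + (\<Sum>t<T. L t (h u t, u t))"

text \<open>Both systems are uniquely solvable on \<open>{0..T}\<close>.\<close>

lemma response_exists: "\<exists>h. is_response T \<phi>0 A u h"
proof -
  define h where "h = rec_nat \<phi>0 (\<lambda>t g. g + lin_comb A (u t) g)"
  have "is_response T \<phi>0 A u h"
    by (simp add: is_response_def h_def)
  then show ?thesis by blast
qed

lemma response_unique:
  assumes "is_response T \<phi>0 A u h" "is_response T \<phi>0 A u h'" "t \<le> T"
  shows "h t = h' t"
  using assms(3)
proof (induction t)
  case 0
  then show ?case using assms by (simp add: is_response_def)
next
  case (Suc t)
  then have "h (Suc t) - h t = lin_comb A (u t) (h t)" "h' (Suc t) - h' t = lin_comb A (u t) (h' t)"
    using assms(1,2) unfolding is_response_def by (meson Suc_le_lessD)+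
  moreover have "h t = h' t" using Suc by simp
  ultimately show ?case by (metis diff_add_cancel)
qed

lemma adjoint_response_exists: "\<exists>hs. is_adjoint_response T A F L u h hs"
proof -
  define G where "G t g = g + lin_comb (\<lambda>i. adjoint (A i)) (u t) g + gradient (\<lambda>g. L t (g, u t)) (h t)"
    for t g
  define r where "r = rec_nat (gradient F (h T)) (\<lambda>n g. G (T - Suc n) g)"
  define hs where "hs t = r (T - t)" for t
  have "hs t = G t (hs (Suc t))" if "t < T" for t
    using that by (simp add: hs_def r_def Suc_diff_Suc[symmetric])
  then have "is_adjoint_response T A F L u h hs"
    by (simp add: is_adjoint_response_def hs_def G_def) (simp add: r_def)
  then show ?thesis by blast
qed

lemma adjoint_response_unique:
  assumes "is_adjoint_response T A F L u h hs" "is_adjoint_response T A F L u h hs'" "t \<le> T"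
  shows "hs t = hs' t"
  using assms(3)
proof (induction t rule: inc_induct)
  case base
  then show ?case using assms by (simp add: is_adjoint_response_def)
next
  case (step t)
  then have "hs (Suc t) - hs t = hs' (Suc t) - hs' t"
    using assms(1,2) unfolding is_adjoint_response_def by metis
  then show ?case using step by simp
qed

end

theory Submission
  imports Defs
begin

text \<open>
  The adjoint response is the derivative of the cost-to-go: when the control is kept fixed from
  time \<open>j\<close> on and the state at time \<open>j\<close> moves with velocity \<open>d\<close>, the remaining cost changes at
  rate \<open>h\<^sup>*\<^sub>j \<bullet> d\<close>. This is shown by backward induction on \<open>j\<close>, one step of which is the adjoint
  equation. Perturbing \<open>u\<^sub>i\<^sub>,\<^sub>t\<close> leaves \<open>h\<^sub>0, \<dots>, h\<^sub>t\<close> fixed and moves \<open>h\<^sub>t\<^sub>+\<^sub>1\<close> with velocity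
  \<open>A\<^sub>i h\<^sub>t\<close>, which gives the formula.
\<close>

section \<open>Riesz representation and adjoint operators\<close>

text \<open>
  The representing vector minimises \<open>J x = \<parallel>x\<parallel>\<^sup>2 - 2 f x\<close>; minimising sequences are Cauchy by the
  parallelogram law.
\<close>

lemma riesz_representation:
  fixes f :: "'a::{real_inner,complete_space} \<Rightarrow> real"
  assumes "bounded_linear f"
  obtains D where "\<And>x. f x = x \<bullet> D"
proof -
  interpret bounded_linear f by fact
  define J where "J x = x \<bullet> x - 2 * f x" for x
  obtain K where K: "\<And>x. norm (f x) \<le> norm x * K"
    using bounded by blast
  \<comment> \<open>Completing the square in \<open>norm x\<close> bounds \<open>J\<close> below, so
    its infimum \<open>m\<close> is finite.\<close>
  have lower: "J x \<ge> - (K\<^sup>2)" for x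
  proof -
    have "f x \<le> norm x * K"
      using K[of x] by simp
    moreover have "0 \<le> (norm x - K)\<^sup>2"
      by simp
    ultimately show ?thesis
      by (simp add: J_def power2_diff flip: power2_norm_eq_inner)
  qed
  define m where "m = Inf (range J)"
  have m_le: "m \<le> J x" for x
    unfolding m_def using lower by (intro cInf_lower bdd_belowI2) auto
  have "\<exists>x. J x < m + 1 / real (Suc n)" for n
    using cInf_lessD[of "range J" "m + 1 / real (Suc n)"] by (auto simp: m_def)
  then obtain X where X: "\<And>n. J (X n) < m + 1 / real (Suc n)"
    by metis
  \<comment> \<open>At the midpoint \<open>z\<close> the linear terms of \<open>J\<close> cancel,
    leaving the parallelogram law; then \<open>J z\<close> is bounded below by
    \<open>m\<close>.\<close>
  have par: "(norm (x - y))\<^sup>2 \<le> 2 * (J x - m) + 2 * (J y - m)" for x y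
  proof -
    define z where "z = (1 / 2) *\<^sub>R (x + y)"
    have "2 * J x + 2 * J y - 4 * J z = (norm (x - y))\<^sup>2"
      by (simp add: J_def z_def power2_norm_eq_inner inner_simps add scaleR inner_commute algebra_simps)
    with m_le[of z] show ?thesis
      by (simp add: algebra_simps)
  qed
  have "Cauchy X"
  proof (rule metric_CauchyI)
    fix e :: real assume "e > 0"
    \<comment> \<open>Beyond \<open>N\<close> the excess of \<open>J (X n)\<close> over
      \<open>m\<close> is below a quarter of \<open>e\<close> squared, which the factors 2 + 2 in
      \<open>par\<close> turn into \<open>e\<close> squared.\<close>
    then obtain N where N: "4 / e\<^sup>2 < real N"
      using reals_Archimedean2 by blast
    have "dist (X a) (X b) < e" if "a \<ge> N" "b \<ge> N" for a b
    proof -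
      have "J (X n) - m < e\<^sup>2 / 4" if "n \<ge> N" for n
      proof -
        have "4 / e\<^sup>2 < real (Suc n)"
          using N that by linarith
        then have "1 / real (Suc n) < e\<^sup>2 / 4"
          using \<open>e > 0\<close> by (simp add: field_simps)
        with X[of n] show ?thesis by linarith
      qed
      from this[OF that(1)] this[OF that(2)] par[of "X a" "X b"]
      have "(norm (X a - X b))\<^sup>2 < e\<^sup>2"
        by (simp add: field_simps)
      then show ?thesis
        using \<open>e > 0\<close> by (simp add: dist_norm power2_less_imp_less)
    qed
    then show "\<exists>M. \<forall>a\<ge>M. \<forall>b\<ge>M. dist (X a) (X b) < e" by blast
  qed
  then obtain D where D: "X \<longlonglongrightarrow> D"
    using Cauchy_convergent convergent_def by blast
  have "(\<lambda>n. J (X n)) \<longlonglongrightarrow> J D"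
    unfolding J_def by (intro tendsto_intros D tendsto)
  moreover have "(\<lambda>n. m + 1 / real (Suc n)) \<longlonglongrightarrow> m"
    using LIMSEQ_inverse_real_of_nat_add[of m] by (simp add: inverse_eq_divide)
  ultimately have "J D \<le> m"
    using X by (intro LIMSEQ_le) (auto intro: less_imp_le)
  have "f y = y \<bullet> D" for y
  proof -
    \<comment> \<open>First variation: \<open>2 * c\<close> is the slope of \<open>J\<close> at the
      minimiser \<open>D\<close> in direction \<open>y\<close>, so it vanishes.\<close>
    define c where "c = y \<bullet> D - f y"
    have quad: "0 \<le> 2 * t * c + t\<^sup>2 * (y \<bullet> y)" for t
    proof -
      have "J (D + t *\<^sub>R y) = J D + 2 * t * c + t\<^sup>2 * (y \<bullet> y)"
        by (simp add: J_def c_def inner_simps add scaleR inner_commute algebra_simps power2_eq_square)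
      with \<open>J D \<le> m\<close> m_le[of "D + t *\<^sub>R y"] show ?thesis by linarith
    qed
    have "((\<lambda>t. 2 * t * c + t\<^sup>2 * (y \<bullet> y)) has_real_derivative 2 * c) (at 0)"
      by (auto intro!: derivative_eq_intros)
    then have "2 * c = 0"
      by (rule DERIV_local_min[where d = 1]) (use quad in auto)
    then show ?thesis by (simp add: c_def)
  qed
  then show thesis by (rule that)
qed

text \<open>The library has this only for Euclidean spaces.\<close>

lemma adjoint_works_hilbert:
  fixes f :: "'a::{real_inner,complete_space} \<Rightarrow> 'b::real_inner"
  assumes "bounded_linear f"
  shows "x \<bullet> adjoint f y = f x \<bullet> y"
proof -
  have "\<exists>z. \<forall>x. f x \<bullet> y = x \<bullet> z" for y
    using riesz_representation[OF bounded_linear_compose[OF bounded_linear_inner_left assms]]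
    by metis
  then have "\<exists>f'. \<forall>x y. f x \<bullet> y = x \<bullet> f' y"
    by metis
  then have "\<forall>x y. f x \<bullet> y = x \<bullet> adjoint f y"
    unfolding adjoint_def by (rule someI_ex)
  then show ?thesis by simp
qed

section \<open>Gradients in Hilbert space\<close>

lemma GDERIV_unique:
  assumes "GDERIV f x :> D" "GDERIV f x :> D'"
  shows "D = D'"
proof -
  have "(\<lambda>h. h \<bullet> D) = (\<lambda>h. h \<bullet> D')"
    using assms unfolding gderiv_def by (rule has_derivative_unique)
  then show ?thesis by (metis vector_eq_ldot)
qed

text \<open>Riesz supplies a representing vector and \<open>GDERIV_unique\<close> makes it the only
  one, so the \<open>THE\<close> in \<open>gradient\<close> denotes it.\<close>

lemma GDERIV_gradient:
  assumes "f differentiable (at x)"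
  shows "GDERIV f x :> gradient f x"
proof -
  obtain f' where f': "(f has_derivative f') (at x)"
    using assms by (auto simp: differentiable_def)
  obtain D where "\<And>y. f' y = y \<bullet> D"
    using riesz_representation[OF has_derivative_bounded_linear[OF f']] by blast
  then have "f' = (\<lambda>y. y \<bullet> D)" by auto
  with f' have "GDERIV f x :> D" by (simp add: gderiv_def)
  then show ?thesis
    unfolding gradient_def using GDERIV_unique by (metis theI)
qed

lemma gradient_chain:
  assumes "f differentiable (at (y s))"
    and "(y has_vector_derivative d) (at s)"
  shows "((\<lambda>s. f (y s)) has_real_derivative gradient f (y s) \<bullet> d) (at s)"
proof -
  have "((\<lambda>s. f (y s)) has_derivative (\<lambda>r. (r *\<^sub>R d) \<bullet> gradient f (y s))) (at s)"
    using has_derivative_compose[OF assms(2)[unfolded has_vector_derivative_def]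
        GDERIV_gradient[OF assms(1), unfolded gderiv_def]] .
  then show ?thesis
    by (simp add: has_field_derivative_def inner_commute mult.commute[of _ "_ \<bullet> _"])
qed

section \<open>Control operators and single-coordinate perturbations\<close>

lemma bounded_linear_lin_comb:
  assumes "\<And>i. bounded_linear (A i)"
  shows "bounded_linear (lin_comb A v)"
  unfolding lin_comb_def
  using assms by (intro bounded_linear_sum bounded_linear_compose[OF bounded_linear_scaleR_right]) auto

lemma inner_lin_comb_adjoint:
  fixes A :: "'q::finite \<Rightarrow> 'h \<Rightarrow> 'h::{real_inner,complete_space}"
  assumes "\<And>i. bounded_linear (A i)"
  shows "x \<bullet> lin_comb (\<lambda>i. adjoint (A i)) v y = lin_comb A v x \<bullet> y"
  by (simp add: lin_comb_def inner_sum_left inner_sum_right adjoint_works_hilbert[OF assms])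

lemma coord_upd_same: "coord_upd v i (v $ i) = v"
  by (simp add: coord_upd_def vec_eq_iff)

lemma coord_upd_eq: "coord_upd v i s = v + (s - v $ i) *\<^sub>R axis i 1"
  by (simp add: coord_upd_def vec_eq_iff axis_def)

lemma lin_comb_coord_upd:
  "lin_comb A (coord_upd v i s) x = lin_comb A v x + (s - v $ i) *\<^sub>R A i x"
proof -
  have "lin_comb A (coord_upd v i s) x
      = (\<Sum>j\<in>UNIV. v $ j *\<^sub>R A j x + (if j = i then (s - v $ i) *\<^sub>R A i x else 0))"
    unfolding lin_comb_def by (rule sum.cong) (auto simp: coord_upd_def algebra_simps)
  then show ?thesis
    by (simp add: lin_comb_def sum.distrib)
qed

text \<open>Causality: with the horizon cut down to \<open>t\<close>, \<open>h'\<close> is also a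
  response to \<open>u\<close>, and uniqueness applies.\<close>

lemma response_cong:
  assumes "is_response T \<phi>0 A u h" "is_response T \<phi>0 A u' h'"
    and "\<And>r. r < t \<Longrightarrow> u r = u' r" "t \<le> T"
  shows "h t = h' t"
proof (rule response_unique)
  show "is_response t \<phi>0 A u h" "is_response t \<phi>0 A u h'"
    using assms by (auto simp: is_response_def)
qed simp

section \<open>Derivative of the cost-to-go\<close>

text \<open>The induction needs an arbitrary velocity \<open>d\<close>, since \<open>d\<close> evolves along the trajectory.\<close>

lemma cost_to_go_derivative:
  fixes A :: "'q::finite \<Rightarrow> 'h \<Rightarrow> 'h::{real_inner,complete_space}"
    and y :: "real \<Rightarrow> nat \<Rightarrow> 'h"
  assumes A: "\<And>i. bounded_linear (A i)"
    and F: "F differentiable (at (y s T))"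
    and L: "\<And>r. r < T \<Longrightarrow> L r differentiable (at (y s r, u r))"
    and adj: "is_adjoint_response T A F L u (y s) hs"
    and y: "\<And>z r. j \<le> r \<Longrightarrow> r < T \<Longrightarrow> y z (Suc r) = y z r + lin_comb A (u r) (y z r)"
    and d: "((\<lambda>z. y z j) has_vector_derivative d) (at s)"
    and "j \<le> T"
  shows "((\<lambda>z. F (y z T) + (\<Sum>r=j..<T. L r (y z r, u r))) has_real_derivative hs j \<bullet> d) (at s)"
  using \<open>j \<le> T\<close> y d
proof (induction j arbitrary: d rule: inc_induct)
  case base
  then show ?case
    using gradient_chain[of F "\<lambda>z. y z T", OF F] adj by (simp add: is_adjoint_response_def)
next
  case (step j)
  let ?B = "lin_comb A (u j)" and ?G = "gradient (\<lambda>g. L j (g, u j)) (y s j)"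
  \<comment> \<open>For a fixed control the dynamics are linear, so the velocity is propagated by
    the same operator as the state.\<close>
  have "((\<lambda>z. y z (Suc j)) has_vector_derivative d + ?B d) (at s)"
    using step.prems(1)[of j] step.hyps
    by (simp add: has_vector_derivative_add step.prems(2)
        bounded_linear.has_vector_derivative[OF bounded_linear_lin_comb[OF A]])
  then have tail: "((\<lambda>z. F (y z T) + (\<Sum>r=Suc j..<T. L r (y z r, u r)))
      has_real_derivative hs (Suc j) \<bullet> (d + ?B d)) (at s)"
    using step.IH step.prems(1) by simp
  \<comment> \<open>Joint differentiability is restricted to the slice with the control frozen at
    \<open>u j\<close>.\<close>
  have "(\<lambda>g. L j (g, u j)) differentiable (at (y s j))"
  proof (rule differentiable_compose[of "L j" "\<lambda>g. (g, u j)", OF L[OF step.hyps(2)]])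
    show "(\<lambda>g. (g, u j)) differentiable (at (y s j))"
      unfolding differentiable_def
      by (auto intro!: derivative_eq_intros)
  qed
  then have head: "((\<lambda>z. L j (y z j, u j)) has_real_derivative ?G \<bullet> d) (at s)"
    by (rule gradient_chain[of "\<lambda>g. L j (g, u j)" "\<lambda>z. y z j"]) (rule step.prems(2))
  have "hs (Suc j) - hs j = - lin_comb (\<lambda>i. adjoint (A i)) (u j) (hs (Suc j)) - ?G"
    using adj step.hyps by (simp add: is_adjoint_response_def)
  then have "hs j = hs (Suc j) + lin_comb (\<lambda>i. adjoint (A i)) (u j) (hs (Suc j)) + ?G"
    by (simp add: algebra_simps)
  \<comment> \<open>Pairing the adjoint equation with \<open>d\<close> moves the operators onto
    \<open>d\<close>; the two terms are the rates in \<open>tail\<close> and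
    \<open>head\<close>.\<close>
  then have "hs j \<bullet> d = hs (Suc j) \<bullet> (d + ?B d) + ?G \<bullet> d"
    using inner_lin_comb_adjoint[of A d "u j" "hs (Suc j)", OF A]
    by (simp add: inner_simps inner_commute)
  then show ?case
    using DERIV_add[OF tail head] step.hyps
    by (simp add: sum.atLeast_Suc_lessThan algebra_simps)
qed

section \<open>Partial derivatives of the cost in the controls\<close>

theorem theorem2p3:
  fixes k :: "'x \<Rightarrow> 'x \<Rightarrow> real"
    and ev :: "'h::{real_inner,complete_space} \<Rightarrow> 'x \<Rightarrow> real"
    and T :: nat
    and \<phi>0 :: 'h
    and A :: "'q::finite \<Rightarrow> 'h \<Rightarrow> 'h"
    and F :: "'h \<Rightarrow> real"
    and L :: "nat \<Rightarrow> 'h \<times> (real ^ 'q) \<Rightarrow> real"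
    and h :: "(nat \<Rightarrow> real ^ 'q) \<Rightarrow> nat \<Rightarrow> 'h"
    and u :: "nat \<Rightarrow> real ^ 'q"
    and hs :: "nat \<Rightarrow> 'h"
  assumes "rkhs k ev"
    and "T > 0"
    and "\<And>i. bounded_linear (A i)"
    and "\<And>g. F differentiable (at g)"
    and "\<And>t p. t < T \<Longrightarrow> L t differentiable (at p)"
    and "\<And>w. is_response T \<phi>0 A w (h w)"
    and "is_adjoint_response T A F L u (h u) hs"
  shows "\<forall>i. \<forall>t<T.
    ((\<lambda>s. cost T F L h (u(t := coord_upd (u t) i s))) has_real_derivative
       hs (Suc t) \<bullet> A i (h u t) + partial_deriv (\<lambda>v. L t (h u t, v)) (u t) i)
      (at (u t $ i))"
proof (intro allI impI)
  fix i t assume t: "t < T"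
  define w where "w s = u(t := coord_upd (u t) i s)" for s
  define s0 where "s0 = u t $ i"
  have w0: "w s0 = u"
    by (simp add: w_def s0_def coord_upd_same)
  note resp = assms(6)
  have past: "h (w s) r = h u r" if "r \<le> t" for s r
    using that t by (intro response_cong[OF resp resp]) (auto simp: w_def)
  have rec: "h (w s) (Suc r) = h (w s) r + lin_comb A (w s r) (h (w s) r)" if "r < T" for s r
    using resp[of "w s"] that by (simp add: is_response_def algebra_simps)
  \<comment> \<open>Since \<open>h (w s) t\<close> does not depend on \<open>s\<close>, the next
    state is affine in \<open>s\<close>.\<close>
  have "((\<lambda>s. h (w s) (Suc t)) has_vector_derivative A i (h u t)) (at s0)"
  proof -
    have "h (w s) (Suc t) = h u t + lin_comb A (u t) (h u t) + (s - s0) *\<^sub>R A i (h u t)" for s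
      unfolding rec[OF t] past[OF order_refl]
      by (simp add: w_def s0_def lin_comb_coord_upd)
    then show ?thesis
      by (auto simp: has_vector_derivative_def intro!: derivative_eq_intros)
  qed
  \<comment> \<open>Cost-to-go from \<open>Suc t\<close>: from there on \<open>w s\<close> agrees
    with \<open>u\<close>, so only the state varies.\<close>
  then have future: "((\<lambda>s. F (h (w s) T) + (\<Sum>r=Suc t..<T. L r (h (w s) r, u r)))
      has_real_derivative hs (Suc t) \<bullet> A i (h u t)) (at s0)"
    using assms(3,4,5,7) t
    by (intro cost_to_go_derivative[where A = A]) (auto simp: w0 rec, simp add: w_def)
  have "(\<lambda>s. (h u t, coord_upd (u t) i s)) differentiable (at s0)"
    unfolding coord_upd_eq differentiable_def by (rule exI) (auto intro!: derivative_eq_intros)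
  then have "(\<lambda>s. L t (h u t, coord_upd (u t) i s)) differentiable (at s0)"
    by (rule differentiable_compose[OF assms(5)[OF t]])
  then have present: "((\<lambda>s. L t (h u t, coord_upd (u t) i s)) has_real_derivative
      partial_deriv (\<lambda>v. L t (h u t, v)) (u t) i) (at s0)"
    by (simp add: partial_deriv_def s0_def DERIV_deriv_iff_real_differentiable)
  \<comment> \<open>Future, present and past: at time \<open>t\<close> only the control argument
    varies, and the costs before \<open>t\<close> are constant in \<open>s\<close>.\<close>
  have cost_split: "cost T F L h (w s) =
      (F (h (w s) T) + (\<Sum>r=Suc t..<T. L r (h (w s) r, u r)))
      + L t (h u t, coord_upd (u t) i s) + (\<Sum>r<t. L r (h u r, u r))" for s
  proof -
    let ?f = "\<lambda>r. L r (h (w s) r, w s r)"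
    have "{..<T} = {..<t} \<union> {t..<T}"
      using t by auto
    then have "sum ?f {..<T} = sum ?f {..<t} + sum ?f {t..<T}"
      by (simp add: sum.union_disjoint ivl_disj_int)
    also have "sum ?f {t..<T} = ?f t + sum ?f {Suc t..<T}"
      using t by (rule sum.atLeast_Suc_lessThan)
    also have "sum ?f {Suc t..<T} = (\<Sum>r=Suc t..<T. L r (h (w s) r, u r))"
      by (rule sum.cong) (auto simp: w_def)
    also have "sum ?f {..<t} = (\<Sum>r<t. L r (h u r, u r))"
      by (rule sum.cong) (auto simp: past, simp add: w_def)
    also have "?f t = L t (h u t, coord_upd (u t) i s)"
      by (simp add: past) (simp add: w_def)
    finally show ?thesis
      by (simp add: cost_def)
  qed
  have "((\<lambda>s. cost T F L h (w s)) has_real_derivative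
      hs (Suc t) \<bullet> A i (h u t) + partial_deriv (\<lambda>v. L t (h u t, v)) (u t) i) (at s0)"
    unfolding cost_split using DERIV_add[OF DERIV_add[OF future present] DERIV_const] by simp
  then show "((\<lambda>s. cost T F L h (u(t := coord_upd (u t) i s))) has_real_derivative
      hs (Suc t) \<bullet> A i (h u t) + partial_deriv (\<lambda>v. L t (h u t, v)) (u t) i) (at (u t $ i))"
    by (simp add: w_def s0_def)
qed

end
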